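(* Let $p_h\in L_2(\Omega)$ be a piecewise linear function, i.e. $p_h|_T\in\mathbb{P}_1(T)$ for every $T\in\mathcal T_h$ (no continuity across edges is required, so $p_h$ need not belong to $V_h$). Then $$a_{pw}(p_h,\,v_h-I_cv_h)=0\qquad\text{for all } v_h\in V_h^0.$$
   Context: $\Omega\subset\mathbb{R}^2$ is a bounded convex polygonal domain and $\mathcal T_h$ is a conforming shape-regular triangulation of $\Omega$ into closed triangles. $\mathbb{P}_k(T)$ denotes polynomials of degree at most $k$ on $T$; $m_e$ is the midpoint of an edge $e$. $V_h$ is the Crouzeix–Raviart space of functions in $L_2(\Omega)$ that are affine on every $T\in\mathcal T_h$ and continuous at $m_e$ for every interior edge $e$; $V_h^0=\{v_h\in V_h:v_h(m_e)=0\text{ for every boundary edge }e\}$. $a_{pw}(v,w)=\sum_{T\in\mathcal T_h}\int_T\nabla v|_T\cdot\nabla w|_T\,dx$ for piecewise $H^1$ functions $v,w$. $V_c=\{v\in H^1_0(\Omega): v|_T\in\mathbb{P}_2(T)\ \forall T\in\mathcal T_h\}$ is the conforming quadratic space; its elements are determined by their values at the vertices and their integrals over the edges of $\mathcal T_h$. The enriching map $I_c:V_h^0\to V_c$ is defined as follows: for $v_h\in V_h^0$, $I_cv_h\in V_c$ is the function with $(I_cv_h)(p)=\frac{1}{|\mathcal T_p|}\sum_{T\in\mathcal T_p}v_h|_T(p)$ for every interior vertex $p$, where $\mathcal T_p$ is the set of triangles having $p$ as a vertex and $|\mathcal T_p|$ its cardinality; $(I_cv_h)(p)=0$ for every boundary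 vertex $p$; and $\int_eI_cv_h\,ds=\int_ev_h\,ds$ for every edge $e$ of $\mathcal T_h$. *)

theory Defs
  imports "HOL-Analysis.Analysis"
begin

text \<open>
  Elements of Lebesgue and Sobolev spaces are represented by total functions
  that matter only up to null sets of the domain in question.
\<close>

section \<open>Sobolev spaces on planar open sets\<close>

primrec times_cont_diff :: "nat \<Rightarrow> (real^2 \<Rightarrow> real) \<Rightarrow> bool" where
  "times_cont_diff 0 f \<longleftrightarrow> continuous_on UNIV f"
| "times_cont_diff (Suc k) f \<longleftrightarrow>
     (\<forall>x. f differentiable (at x)) \<and>
     (\<forall>i. times_cont_diff k (\<lambda>x. frechet_derivative f (at x) (axis i 1)))"

definition test_functions :: "(real^2) set \<Rightarrow> (real^2 \<Rightarrow> real) set" where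
  "test_functions U =
     {\<phi>. (\<forall>k. times_cont_diff k \<phi>) \<and> (\<exists>K. compact K \<and> K \<subseteq> U \<and> (\<forall>x. x \<notin> K \<longrightarrow> \<phi> x = 0))}"

definition square_integrable :: "(real^2) set \<Rightarrow> (real^2 \<Rightarrow> 'b::euclidean_space) \<Rightarrow> bool" where
  "square_integrable U f \<longleftrightarrow>
     f \<in> borel_measurable (lebesgue_on U) \<and> integrable (lebesgue_on U) (\<lambda>x. (norm (f x))\<^sup>2)"

definition is_weak_gradient ::
    "(real^2) set \<Rightarrow> (real^2 \<Rightarrow> real) \<Rightarrow> (real^2 \<Rightarrow> real^2) \<Rightarrow> bool" where
  "is_weak_gradient U v g \<longleftrightarrow>
     square_integrable U g \<and>
     (\<forall>\<phi>\<in>test_functions U. \<forall>i.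
        (LINT x|lebesgue_on U. v x * frechet_derivative \<phi> (at x) (axis i 1)) =
        - (LINT x|lebesgue_on U. g x $ i * \<phi> x))"

text \<open>The weak gradient is determined up to a null set of \<open>U\<close>; outside \<open>U\<close> it is arbitrary.\<close>

definition weak_gradient :: "(real^2) set \<Rightarrow> (real^2 \<Rightarrow> real) \<Rightarrow> real^2 \<Rightarrow> real^2" where
  "weak_gradient U v = (SOME g. is_weak_gradient U v g)"

definition H1 :: "(real^2) set \<Rightarrow> (real^2 \<Rightarrow> real) set" where
  "H1 U = {v. square_integrable U v \<and> (\<exists>g. is_weak_gradient U v g)}"

definition H1_norm :: "(real^2) set \<Rightarrow> (real^2 \<Rightarrow> real) \<Rightarrow> real" where
  "H1_norm U v =
     sqrt ((LINT x|lebesgue_on U. (v x)\<^sup>2) + (LINT x|lebesgue_on U. (norm (weak_gradient U v x))\<^sup>2))"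

definition H10 :: "(real^2) set \<Rightarrow> (real^2 \<Rightarrow> real) set" where
  "H10 U = {v \<in> H1 U. \<exists>\<phi>. (\<forall>n::nat. \<phi> n \<in> test_functions U) \<and>
                          (\<lambda>n. H1_norm U (\<lambda>x. v x - \<phi> n x)) \<longlonglongrightarrow> 0}"

section \<open>Domains and meshes\<close>

definition convex_polygonal_domain :: "(real^2) set \<Rightarrow> bool" where
  "convex_polygonal_domain \<Omega> \<longleftrightarrow>
     open \<Omega> \<and> \<Omega> \<noteq> {} \<and> bounded \<Omega> \<and> convex \<Omega> \<and> polytope (closure \<Omega>)"

text \<open>
  The library predicate \<^const>\<open>triangulation\<close> contains conformity: any two members
  intersect in a common (possibly empty) face.
\<close>

definition conforming_mesh :: "(real^2) set \<Rightarrow> (real^2) set set \<Rightarrow> bool" where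
  "conforming_mesh \<Omega> \<T> \<longleftrightarrow>
     triangulation \<T> \<and> (\<forall>T\<in>\<T>. 2 simplex T) \<and> \<Union>\<T> = closure \<Omega>"

definition shape_regular :: "real \<Rightarrow> (real^2) set set \<Rightarrow> bool" where
  "shape_regular \<sigma> \<T> \<longleftrightarrow> \<sigma> > 0 \<and> (\<forall>T\<in>\<T>. \<exists>z. cball z (diameter T / \<sigma>) \<subseteq> T)"

section \<open>Piecewise polynomials and the broken energy form\<close>

definition polynomials :: "nat \<Rightarrow> (real^2 \<Rightarrow> real) set" where
  "polynomials k = {q. \<exists>c. \<forall>x. q x = (\<Sum>i\<le>k. \<Sum>j\<le>k-i. c i j * (x $ 1) ^ i * (x $ 2) ^ j)}"

definition piecewise_polynomial :: "nat \<Rightarrow> (real^2) set set \<Rightarrow> (real^2 \<Rightarrow> real) \<Rightarrow> bool" where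
  "piecewise_polynomial k \<T> v \<longleftrightarrow>
     (\<forall>T\<in>\<T>. \<exists>q\<in>polynomials k. AE x in lebesgue_on T. v x = q x)"

text \<open>
  \<open>restr v T\<close> is \<open>v|\<^sub>T\<close> for a function \<open>v\<close> that has a continuous representative on the closed
  triangle \<open>T\<close>. On \<open>T\<close>, including its edges and vertices, the values are uniquely
  determined; values outside \<open>T\<close> are meaningless.
\<close>

definition restr :: "(real^2 \<Rightarrow> real) \<Rightarrow> (real^2) set \<Rightarrow> real^2 \<Rightarrow> real" where
  "restr v T = (SOME q. continuous_on T q \<and> (AE x in lebesgue_on T. v x = q x))"

definition a_pw :: "(real^2) set set \<Rightarrow> (real^2 \<Rightarrow> real) \<Rightarrow> (real^2 \<Rightarrow> real) \<Rightarrow> real" where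
  "a_pw \<T> v w =
     (\<Sum>T\<in>\<T>. LINT x|lebesgue_on T. weak_gradient (interior T) v x \<bullet> weak_gradient (interior T) w x)"

section \<open>The finite element spaces\<close>

text \<open>
  Edges are given by their end points. An edge is a boundary edge if it lies in the
  frontier of the domain, and an interior edge otherwise. Continuity of an \<open>L\<^sub>2\<close> class at a
  point means that some representative of it is continuous there.
\<close>

definition CR :: "(real^2) set \<Rightarrow> (real^2) set set \<Rightarrow> (real^2 \<Rightarrow> real) set" where
  "CR \<Omega> \<T> =
     {v. square_integrable \<Omega> v \<and> piecewise_polynomial 1 \<T> v \<and>
         (\<forall>T\<in>\<T>. \<forall>a b. closed_segment a b edge_of T \<and> \<not> closed_segment a b \<subseteq> frontier \<Omega> \<longrightarrow>
            (\<exists>u. (AE x in lebesgue_on \<Omega>. u x = v x) \<and> isCont u (midpoint a b)))}"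

definition CR0 :: "(real^2) set \<Rightarrow> (real^2) set set \<Rightarrow> (real^2 \<Rightarrow> real) set" where
  "CR0 \<Omega> \<T> =
     {v \<in> CR \<Omega> \<T>.
        \<forall>T\<in>\<T>. \<forall>a b. closed_segment a b edge_of T \<and> closed_segment a b \<subseteq> frontier \<Omega> \<longrightarrow>
          restr v T (midpoint a b) = 0}"

definition Vc :: "(real^2) set \<Rightarrow> (real^2) set set \<Rightarrow> (real^2 \<Rightarrow> real) set" where
  "Vc \<Omega> \<T> = {v \<in> H10 \<Omega>. piecewise_polynomial 2 \<T> v}"

definition triangles_at :: "(real^2) set set \<Rightarrow> real^2 \<Rightarrow> (real^2) set set" where
  "triangles_at \<T> p = {T\<in>\<T>. p extreme_point_of T}"

text \<open>The arc length integral of \<open>f\<close> over the segment from \<open>a\<close> to \<open>b\<close>.\<close>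

definition segment_integral :: "real^2 \<Rightarrow> real^2 \<Rightarrow> (real^2 \<Rightarrow> real) \<Rightarrow> real" where
  "segment_integral a b f = dist a b * integral {0..1} (\<lambda>t. f (linepath a b t))"

text \<open>
  Vertex values of \<open>w \<in> Vc\<close>, and edge integrals of \<open>w\<close> and of \<open>v \<in> CR0\<close>, may be computed
  from the restriction to any triangle containing the vertex or edge: \<open>w\<close> is continuous, and
  the jump of \<open>v\<close> across an interior edge is affine and vanishes at the midpoint.
\<close>

definition is_enrichment ::
    "(real^2) set \<Rightarrow> (real^2) set set \<Rightarrow> (real^2 \<Rightarrow> real) \<Rightarrow> (real^2 \<Rightarrow> real) \<Rightarrow> bool" where
  "is_enrichment \<Omega> \<T> v w \<longleftrightarrow>
     w \<in> Vc \<Omega> \<T> \<and>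
     (\<forall>p\<in>\<Omega>. \<forall>S\<in>triangles_at \<T> p.
        restr w S p = (\<Sum>T\<in>triangles_at \<T> p. restr v T p) / real (card (triangles_at \<T> p))) \<and>
     (\<forall>p\<in>frontier \<Omega>. \<forall>S\<in>triangles_at \<T> p. restr w S p = 0) \<and>
     (\<forall>T\<in>\<T>. \<forall>a b. closed_segment a b edge_of T \<longrightarrow>
        segment_integral a b (restr w T) = segment_integral a b (restr v T))"

definition enriching_map ::
    "(real^2) set \<Rightarrow> (real^2) set set \<Rightarrow> ((real^2 \<Rightarrow> real) \<Rightarrow> (real^2 \<Rightarrow> real)) \<Rightarrow> bool" where
  "enriching_map \<Omega> \<T> I\<^sub>c \<longleftrightarrow> (\<forall>v\<in>CR0 \<Omega> \<T>. is_enrichment \<Omega> \<T> v (I\<^sub>c v))"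

end

theory Submission
  imports Defs
begin

text \<open>
  Fix a triangle with vertices \<open>a\<close>, \<open>b\<close>, \<open>c\<close> and centroid \<open>m\<close>. There the difference of the two
  functions is a quadratic polynomial \<open>r\<close> whose integrals over the three edges vanish, and the
  gradient of the piecewise linear function is a constant. For every quadratic \<open>r\<close> the means over
  the edges \<open>ac\<close> and \<open>bc\<close> differ by half the derivative of \<open>r\<close> at \<open>m\<close> in the direction \<open>a - b\<close>; so
  here the gradient of \<open>r\<close> vanishes at \<open>m\<close>. As it is affine, its integral over the triangle is \<open>0\<close>.

  Weak gradients are identified with classical ones by testing against smooth bumps that converge
  to indicators of boxes: an integrable function orthogonal to all of them has zero integral over
  every box, hence is null.
\<close>

section \<open>Two facts on Lebesgue integrals\<close>

text \<open>The positive and the negative part are densities of two measures that agree on all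
  boxes. Boxes are stable under intersection and generate the Borel sets, so the measures coincide,
  and so do the parts almost everywhere.\<close>

lemma AE_zero_if_box_integrals_zero:
  fixes f :: "'a::euclidean_space \<Rightarrow> real"
  assumes f: "integrable lebesgue f"
    and zero: "\<And>a b. (LINT x|lebesgue. indicator (box a b) x * f x) = 0"
  shows "AE x in lebesgue. f x = 0"
proof -
  have fm: "f \<in> borel_measurable lebesgue"
    using f by simp
  \<comment> \<open>Uniqueness of measures is argued on Borel sets, so \<open>f\<close> is first
    replaced by a Borel function equal to it almost everywhere.\<close>
  obtain g where g[measurable]: "g \<in> borel_measurable lborel" and fg: "AE x in lborel. f x = g x"
    using completion_ex_borel_measurable_real[OF fm] by blast
  have fg': "AE x in lebesgue. f x = g x"
    using fg by (simp add: AE_completion_iff)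
  have g_leb: "g \<in> borel_measurable lebesgue"
    using g by (simp add: measurable_completion)
  have ig: "integrable lborel g"
    using integrable_cong_AE[OF fm g_leb fg'] f integrable_completion[OF g] by blast
  have zero_g: "(LINT x|lborel. indicator (box a b) x * g x) = 0" for a b
  proof -
    have "(LINT x|lborel. indicator (box a b) x * g x) = (LINT x|lebesgue. indicator (box a b) x * g x)"
      by (rule integral_completion[symmetric]) measurable
    also have "\<dots> = (LINT x|lebesgue. indicator (box a b) x * f x)"
      using fg' fm g_leb by (intro integral_cong_AE) (auto intro!: borel_measurable_times borel_measurable_indicator)
    finally show ?thesis using zero by simp
  qed
  define P where "P = (\<lambda>x. max 0 (g x))"
  define N where "N = (\<lambda>x. max 0 (- g x))"
  have PN[measurable]: "P \<in> borel_measurable lborel" "N \<in> borel_measurable lborel"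
    unfolding P_def N_def by measurable
  have int: "integrable lborel P" "integrable lborel N"
    unfolding P_def N_def using ig by auto
  have emeas: "emeasure (density lborel (\<lambda>x. ennreal (h x))) X = ennreal (LINT x|lborel. indicator X x * h x)"
    if h: "integrable lborel h" "\<And>x. h x \<ge> 0" and X: "X \<in> sets borel" for h :: "'a \<Rightarrow> real" and X
  proof -
    have "emeasure (density lborel (\<lambda>x. ennreal (h x))) X = (\<integral>\<^sup>+x. ennreal (indicator X x * h x) \<partial>lborel)"
      using h X by (subst emeasure_density)
        (auto intro!: nn_integral_cong split: split_indicator)
    also have "\<dots> = ennreal (LINT x|lborel. indicator X x * h x)"
      using h X integrable_mult_indicator[of X lborel h] by (intro nn_integral_eq_integral) auto
    finally show ?thesis .
  qed
  have "density lborel P = density lborel N"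
  proof (rule measure_eqI_generator_eq)
    let ?E = "range (\<lambda>(a, b). box a b::'a set)"
    \<comment> \<open>Agreement on a generator determines the measures once an exhausting sequence
      of sets of finite measure is at hand.\<close>
    let ?A = "\<lambda>n::nat. box (- (real n *\<^sub>R One)) (real n *\<^sub>R One) :: 'a set"
    show "Int_stable ?E"
      by (auto simp: Int_stable_def box_Int_box)
    show "?E \<subseteq> Pow UNIV" "sets (density lborel P) = sigma_sets UNIV ?E"
      "sets (density lborel N) = sigma_sets UNIV ?E"
      by (simp_all add: borel_eq_box)
    show "range ?A \<subseteq> ?E" "(\<Union>i. ?A i) = UNIV"
      unfolding UN_box_eq_UNIV by auto
    show "emeasure (density lborel P) (?A i) \<noteq> \<infinity>" for i
      using emeas[OF int(1)] by (simp add: P_def)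
    show "emeasure (density lborel P) X = emeasure (density lborel N) X" if XE: "X \<in> ?E" for X
    proof -
      obtain a b where X: "X = box a b" using XE by force
      have i: "integrable lborel (\<lambda>x. indicator X x * P x)" "integrable lborel (\<lambda>x. indicator X x * N x)"
        using integrable_mult_indicator[of X lborel P] integrable_mult_indicator[of X lborel N] int
        by (simp_all add: X)
      have "(LINT x|lborel. indicator X x * P x) - (LINT x|lborel. indicator X x * N x)
          = (LINT x|lborel. indicator X x * g x)"
        unfolding Bochner_Integration.integral_diff[OF i, symmetric]
        by (rule Bochner_Integration.integral_cong) (auto simp: P_def N_def max_def)
      then show ?thesis
        using zero_g emeas[OF int(1)] emeas[OF int(2)] by (simp add: P_def N_def X)
    qed
  qed
  then have "AE x in lborel. ennreal (P x) = ennreal (N x)"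
    by (subst (asm) sigma_finite_measure.density_unique_iff[OF sigma_finite_lborel]) auto
  \<comment> \<open>At each point at least one of \<open>P x\<close> and \<open>N x\<close> is 0, so
    their equality forces both to be 0.\<close>
  then have "AE x in lborel. g x = 0"
    by eventually_elim (auto simp: P_def N_def max_def ennreal_eq_0_iff split: if_splits)
  then have "AE x in lebesgue. g x = 0"
    by (simp add: AE_completion_iff)
  with fg' show ?thesis by eventually_elim simp
qed

text \<open>The complement of \<open>K\<close> is open, so near \<open>x\<close> the function is
  constantly 0, and derivatives are unique.\<close>

lemma has_derivative_eq_0_outside:
  fixes f :: "'a::euclidean_space \<Rightarrow> real"
  assumes "compact K" and zero: "\<And>x. x \<notin> K \<Longrightarrow> f x = 0"
    and "(f has_derivative f') (at x)" and "x \<notin> K"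
  shows "f' v = 0"
proof -
  have "open (- K)" using \<open>compact K\<close> by (simp add: compact_imp_closed open_Compl)
  then have "((\<lambda>_. 0) has_derivative f') (at x)"
    using has_derivative_transform_within_open[OF assms(3), of "- K" "\<lambda>_. 0"] assms(4) zero by auto
  then show ?thesis using has_derivative_unique[of "\<lambda>_. 0" f' x "\<lambda>_. 0"] by (simp add: fun_eq_iff)
qed

text \<open>The difference quotients have integral \<open>0\<close> by translation invariance.\<close>

lemma integral_directional_derivative_eq_0:
  fixes f :: "'a::euclidean_space \<Rightarrow> real"
  assumes "compact K" and zero: "\<And>x. x \<notin> K \<Longrightarrow> f x = 0"
    and deriv: "\<And>x. (f has_derivative f' x) (at x)"
    and cont: "continuous_on UNIV (\<lambda>x. f' x v)"
  shows "(LINT x|lborel. f' x v) = 0"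
proof -
  have f'0: "f' x v = 0" if "x \<notin> K" for x
    using has_derivative_eq_0_outside[OF \<open>compact K\<close> zero deriv that] .
  have "bounded ((\<lambda>x. f' x v) ` K)"
    using \<open>compact K\<close> cont compact_continuous_image compact_imp_bounded continuous_on_subset subset_UNIV
    by metis
  then obtain B0 where "\<And>x. x \<in> K \<Longrightarrow> \<bar>f' x v\<bar> \<le> B0"
    by (auto simp: bounded_iff)
  then obtain B where B: "\<And>x. \<bar>f' x v\<bar> \<le> B" "B \<ge> 0"
    by (metis abs_ge_zero abs_zero f'0 le_max_iff_disj max.cobounded2)
  obtain R where R: "\<And>x. x \<in> K \<Longrightarrow> norm x \<le> R"
    using \<open>compact K\<close> compact_imp_bounded bounded_iff by metis
  have fc: "continuous_on UNIV f"
    using has_derivative_continuous[OF deriv] by (auto intro!: continuous_at_imp_continuous_on)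
  have fm[measurable]: "f \<in> borel_measurable borel"
    using fc by (rule borel_measurable_continuous_onI)
  have f'm[measurable]: "(\<lambda>x. f' x v) \<in> borel_measurable borel"
    using cont by (rule borel_measurable_continuous_onI)
  have "integrable lborel (\<lambda>x. indicator K x *\<^sub>R f x)"
    using \<open>compact K\<close> fc by (intro borel_integrable_compact) (auto intro: continuous_on_subset)
  moreover have "(\<lambda>x. indicator K x *\<^sub>R f x) = f"
    using zero by (auto simp: fun_eq_iff indicator_def)
  ultimately have intf: "integrable lborel f" by simp
  \<comment> \<open>The steps are at most 1, so a translate moves a point by at most
    \<open>norm v\<close>; this bounds the supports of all the quotients \<open>s n\<close> at
    once.\<close>
  define t where "t = (\<lambda>n. 1 / real (Suc n))"
  have t: "t n > 0" "t n \<le> 1" for n by (auto simp: t_def)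
  define s where "s = (\<lambda>n x. (f (t n *\<^sub>R v + x) - f x) / t n)"
  have line: "((\<lambda>r. f (r *\<^sub>R v + x)) has_derivative (\<lambda>h. h * f' (r *\<^sub>R v + x) v)) (at r within S)" for r x S
  proof -
    have "((\<lambda>r. f (r *\<^sub>R v + x)) has_derivative (\<lambda>h. f' (r *\<^sub>R v + x) (h *\<^sub>R v))) (at r within S)"
      by (rule has_derivative_compose[OF _ deriv]) (auto intro!: derivative_eq_intros)
    moreover have "f' y (h *\<^sub>R v) = h * f' y v" for h y
      using linear_scale[OF has_derivative_linear[OF deriv[of y]]] by simp
    ultimately show ?thesis by simp
  qed
  \<comment> \<open>Domination: in the ball the mean value theorem between \<open>x\<close> and its
    translate gives \<open>B\<close>; outside it neither \<open>x\<close> nor its translate lies in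
    \<open>K\<close>, and the quotient is 0.\<close>
  have bound: "\<bar>s n x\<bar> \<le> B * indicator (cball 0 (R + norm v)) x" for n x
  proof (cases "norm x \<le> R + norm v")
    case True
    obtain \<xi> where "f (t n *\<^sub>R v + x) - f (0 *\<^sub>R v + x) = t n * f' (\<xi> *\<^sub>R v + x) v"
      using mvt_simple[of 0 "t n" "\<lambda>r. f (r *\<^sub>R v + x)" "\<lambda>r h. h * f' (r *\<^sub>R v + x) v", OF t(1) line]
      by auto
    then have "s n x = f' (\<xi> *\<^sub>R v + x) v" using t(1)[of n] by (simp add: s_def)
    then show ?thesis using B True by simp
  next
    case False
    have "x \<notin> K" using R[of x] False norm_ge_zero[of v] by linarith
    moreover have "norm x \<le> norm (t n *\<^sub>R v + x) + norm (t n *\<^sub>R v)"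
      using norm_triangle_ineq4[of "t n *\<^sub>R v + x" "t n *\<^sub>R v"] by simp
    then have "norm (t n *\<^sub>R v + x) > R"
      using False t[of n] mult_left_le_one_le[of "norm v" "t n"] by simp
    then have "t n *\<^sub>R v + x \<notin> K" using R by fastforce
    ultimately show ?thesis using zero B by (simp add: s_def)
  qed
  have lim: "(\<lambda>n. s n x) \<longlonglongrightarrow> f' x v" for x
  proof -
    have "((\<lambda>r. f (r *\<^sub>R v + x)) has_field_derivative f' x v) (at 0)"
      using line[of x 0 UNIV] by (simp add: has_field_derivative_def mult_commute_abs)
    then have "((\<lambda>h. (f (h *\<^sub>R v + x) - f x) / h) \<longlongrightarrow> f' x v) (at 0)"
      by (simp add: DERIV_def)
    moreover have "filterlim t (at 0) sequentially"
      unfolding filterlim_at t_def using LIMSEQ_inverse_real_of_nat by (auto simp: inverse_eq_divide)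
    ultimately show ?thesis unfolding s_def by (rule filterlim_compose)
  qed
  have "(LINT x|lborel. s n x) = 0" for n
  proof -
    have tr: "distr lborel borel ((+) (t n *\<^sub>R v)) = lborel" by (rule lborel_distr_plus)
    have "(LINT x|lborel. f x) = (LINT x|lborel. f (t n *\<^sub>R v + x))"
      by (subst tr[symmetric], subst integral_distr) auto
    moreover have "integrable lborel (\<lambda>x. f (t n *\<^sub>R v + x))"
      using integrable_distr[of "(+) (t n *\<^sub>R v)" lborel borel f] intf tr by simp
    ultimately show ?thesis using intf by (simp add: s_def)
  qed
  moreover have "(\<lambda>n. LINT x|lborel. s n x) \<longlonglongrightarrow> (LINT x|lborel. f' x v)"
  proof (rule integral_dominated_convergence)
    show "integrable lborel (\<lambda>x. B * indicator (cball 0 (R + norm v)) x)"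
      by (intro integrable_mult_right integrable_real_indicator)
         (simp_all add: emeasure_bounded_finite[OF bounded_cball, unfolded infinity_ennreal_def])
    show "s n \<in> borel_measurable lborel" for n
      unfolding s_def measurable_lborel2 using t(1)[of n]
      by (intro borel_measurable_continuous_onI continuous_intros continuous_on_compose2[OF fc]) auto
    show "AE x in lborel. norm (s n x) \<le> B * indicator (cball 0 (R + norm v)) x" for n
      using bound by simp
  qed (use lim in simp_all)
  ultimately have "(\<lambda>n. 0) \<longlonglongrightarrow> (LINT x|lborel. f' x v)"
    by simp
  then show ?thesis using LIMSEQ_unique tendsto_const by metis
qed

section \<open>Smooth bump functions\<close>

text \<open>\<open>frechet_derivative\<close> is a choice operator; by uniqueness of derivatives any
  explicitly known derivative may take its place.\<close>

lemma times_cont_diff_SucI: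
  assumes "\<And>x. (f has_derivative f' x) (at x)"
    and "\<And>i. times_cont_diff k (\<lambda>x. f' x (axis i 1))"
  shows "times_cont_diff (Suc k) f"
proof -
  have "frechet_derivative f (at x) = f' x" for x
    using assms(1) frechet_derivative_at by metis
  then show ?thesis using assms by (auto simp: differentiable_def)
qed

lemma times_cont_diff_has_derivative:
  "times_cont_diff (Suc k) f \<Longrightarrow> (f has_derivative frechet_derivative f (at x)) (at x)"
  using frechet_derivative_works by auto

lemma times_cont_diff_continuous: "times_cont_diff k f \<Longrightarrow> continuous_on UNIV f"
  by (cases k) (auto intro!: continuous_at_imp_continuous_on differentiable_imp_continuous_within)

lemma times_cont_diff_SucD: "times_cont_diff (Suc k) f \<Longrightarrow> times_cont_diff k f"
proof (induction k arbitrary: f)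
  case 0
  then show ?case using times_cont_diff_continuous by fastforce
next
  case (Suc k)
  then show ?case by (metis times_cont_diff.simps(2))
qed

lemma times_cont_diff_add:
  "times_cont_diff k f \<Longrightarrow> times_cont_diff k g \<Longrightarrow> times_cont_diff k (\<lambda>x. f x + g x)"
proof (induction k arbitrary: f g)
  case 0
  then show ?case by (auto intro: continuous_intros)
next
  case (Suc k)
  show ?case
    by (rule times_cont_diff_SucI[OF has_derivative_add[OF Suc.prems[THEN times_cont_diff_has_derivative]]])
       (use Suc in auto)
qed

lemma times_cont_diff_mult:
  "times_cont_diff k f \<Longrightarrow> times_cont_diff k g \<Longrightarrow> times_cont_diff k (\<lambda>x. f x * g x)"
proof (induction k arbitrary: f g)
  case 0
  then show ?case by (auto intro: continuous_intros)
next
  case (Suc k)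
  \<comment> \<open>The product rule leaves one factor undifferentiated, so its order must be
    lowered by \<open>times_cont_diff_SucD\<close>.\<close>
  show ?case
    by (rule times_cont_diff_SucI[OF has_derivative_mult[OF Suc.prems[THEN times_cont_diff_has_derivative]]])
       (use Suc times_cont_diff_SucD in \<open>auto intro!: times_cont_diff_add\<close>)
qed

lemma times_cont_diff_const: "times_cont_diff k (\<lambda>_. c)"
proof (induction k arbitrary: c)
  case (Suc k)
  show ?case by (rule times_cont_diff_SucI[OF has_derivative_const]) (use Suc in auto)
qed auto

text \<open>The classical smooth flat function. The factor \<open>1 / t ^ m\<close> makes the family
  closed under differentiation up to linear combinations, and letting \<open>s\<close> tend to 0
  yields the indicator of the positive half-line when \<open>m\<close> is 0.\<close>

definition exp_flat :: "real \<Rightarrow> nat \<Rightarrow> real \<Rightarrow> real" where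
  "exp_flat s m t = (if t > 0 then exp (- s / t) / t ^ m else 0)"

text \<open>For \<open>t > 0\<close> the substitution \<open>u = s / t\<close> gives
  \<open>u ^ m / exp u\<close> up to the factor \<open>1 / s ^ m\<close>, and exponentials dominate
  powers. From the left the function is 0.\<close>

lemma exp_flat_tendsto_0:
  assumes "s > 0"
  shows "(exp_flat s m \<longlongrightarrow> 0) (at 0)"
proof -
  have "filterlim (\<lambda>t. s / t) at_top (at_right 0)"
    using filterlim_tendsto_pos_mult_at_top[OF tendsto_const assms filterlim_inverse_at_top_right]
    by (simp add: divide_inverse)
  from tendsto_mult_left[OF filterlim_compose[OF tendsto_power_div_exp_0[of m] this], of "1 / s ^ m"]
  have "((\<lambda>t. exp (- s / t) / t ^ m) \<longlongrightarrow> 0) (at_right 0)"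
  proof (rule Lim_transform_eventually[OF _ eventuallyI, THEN tendsto_eq_rhs])
    fix t show "1 / s ^ m * ((s / t) ^ m / exp (s / t)) = exp (- s / t) / t ^ m"
      using assms by (simp add: exp_minus power_divide divide_simps)
  qed simp
  then have "(exp_flat s m \<longlongrightarrow> 0) (at_right 0)"
    by (rule Lim_transform_eventually) (auto simp: exp_flat_def eventually_at_filter)
  moreover have "(exp_flat s m \<longlongrightarrow> 0) (at_left 0)"
    by (rule Lim_transform_eventually[OF tendsto_const]) (auto simp: exp_flat_def eventually_at_filter)
  ultimately show ?thesis by (simp add: filterlim_at_split)
qed

text \<open>Only \<open>t = 0\<close> is delicate: the difference quotient of
  \<open>exp_flat s m\<close> there is \<open>exp_flat s (m + 1)\<close>, which tends to 0, in
  agreement with the formula because every \<open>exp_flat\<close> is 0 at 0.\<close>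

lemma exp_flat_has_derivative:
  assumes s: "s > 0"
  shows "(exp_flat s m has_field_derivative s * exp_flat s (m + 2) t - m * exp_flat s (m + 1) t) (at t)"
proof (cases t "0::real" rule: linorder_cases)
  case less
  have "((\<lambda>_. 0) has_field_derivative 0) (at t)" by simp
  then have "(exp_flat s m has_field_derivative 0) (at t)"
    by (rule has_field_derivative_transform_within_open[of _ _ _ "{..<0}"]) (use less in \<open>auto simp: exp_flat_def\<close>)
  then show ?thesis using less by (simp add: exp_flat_def)
next
  case equal
  have "((\<lambda>h. (exp_flat s m (0 + h) - exp_flat s m 0) / h) \<longlongrightarrow> 0) (at 0)"
    by (rule Lim_transform_eventually[OF exp_flat_tendsto_0[OF s, of "m + 1"]])
       (auto simp: exp_flat_def eventually_at_filter)
  then show ?thesis using equal by (simp add: DERIV_def exp_flat_def)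
next
  case greater
  have "((\<lambda>t. exp (- s / t) / t ^ m) has_field_derivative
     s * (exp (- s / t) / t ^ (m + 2)) - m * (exp (- s / t) / t ^ (m + 1))) (at t)"
    using greater
    by (cases m) (auto intro!: derivative_eq_intros simp: divide_simps,
        simp_all add: algebra_simps, metis One_nat_def power_minus_mult mult.commute neq0_conv)
  then have "(exp_flat s m has_field_derivative
     s * (exp (- s / t) / t ^ (m + 2)) - m * (exp (- s / t) / t ^ (m + 1))) (at t)"
    by (rule has_field_derivative_transform_within_open[of _ _ _ "{0<..}"]) (use greater in \<open>auto simp: exp_flat_def\<close>)
  then show ?thesis using greater by (simp add: exp_flat_def)
qed

text \<open>Each derivative raises \<open>m\<close> by 1 and by 2, hence the induction over
  \<open>k\<close> for all \<open>m\<close>. Slopes 1 and -1 of the affine argument later provide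
  the two sides of an interval.\<close>

lemma times_cont_diff_exp_flat:
  assumes s: "s > 0"
  shows "times_cont_diff k (\<lambda>x. exp_flat s m (\<alpha> * x $ j + \<beta>))"
proof (induction k arbitrary: m)
  case 0
  have "continuous_on UNIV (exp_flat s m)"
    using DERIV_isCont exp_flat_has_derivative[OF s] by (blast intro: continuous_at_imp_continuous_on)
  then show ?case
    using continuous_on_compose2[of UNIV "exp_flat s m" UNIV "\<lambda>x. \<alpha> * x $ j + \<beta>"]
    by (simp add: continuous_on_add continuous_on_mult continuous_on_component)
next
  case (Suc k)
  let ?L = "\<lambda>x::real^2. \<alpha> * x $ j + \<beta>"
  let ?D = "\<lambda>t. s * exp_flat s (m + 2) t + - m * exp_flat s (m + 1) t"
  show ?case
  proof (rule times_cont_diff_SucI)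
    fix x
    have "(?L has_derivative (\<lambda>h. \<alpha> * h $ j)) (at x)"
      by (auto intro!: derivative_eq_intros bounded_linear_imp_has_derivative)
    from has_derivative_compose[OF this exp_flat_has_derivative[OF s, of m, THEN has_field_derivative_imp_has_derivative]]
    show "((\<lambda>x. exp_flat s m (?L x)) has_derivative (\<lambda>h. ?D (?L x) * (\<alpha> * h $ j))) (at x)"
      by simp
    show "times_cont_diff k (\<lambda>x. ?D (?L x) * (\<alpha> * axis i 1 $ j))" for i
      by (intro times_cont_diff_add times_cont_diff_mult times_cont_diff_const Suc)
  qed
qed

section \<open>Weak gradients\<close>

lemma borel_measurable_lebesgue_on_AE:
  fixes f g :: "'a::euclidean_space \<Rightarrow> 'b::euclidean_space"
  assumes S: "S \<in> sets lebesgue" and f: "f \<in> borel_measurable (lebesgue_on S)"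
    and fg: "AE x in lebesgue_on S. f x = g x"
  shows "g \<in> borel_measurable (lebesgue_on S)"
proof -
  have "AE x in lebesgue. x \<in> S \<longrightarrow> f x = g x"
    using fg S by (simp add: AE_restrict_space_iff)
  then have "AE x in lebesgue. indicator S x *\<^sub>R f x = indicator S x *\<^sub>R g x"
    by eventually_elim (auto simp: indicator_def)
  moreover have "(\<lambda>x. indicator S x *\<^sub>R f x) \<in> borel_measurable lebesgue"
    using f S by (simp add: borel_measurable_restrict_space_iff)
  ultimately have "(\<lambda>x. indicator S x *\<^sub>R g x) \<in> borel_measurable lebesgue"
    by (intro borel_measurable_AE[where g="\<lambda>x. indicator S x *\<^sub>R g x"])
  then show ?thesis using S by (simp add: borel_measurable_restrict_space_iff)
qed

text \<open>Measurability is asked of \<open>f\<close> only, since completeness of Lebesgue measure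
  passes it on to \<open>g\<close>. Thus integrands built from \<open>weak_gradient\<close> can be
  replaced without a separate measurability proof.\<close>

lemma integral_cong_AE_lebesgue_on:
  fixes f g :: "'a::euclidean_space \<Rightarrow> 'b::euclidean_space"
  assumes "S \<in> sets lebesgue" "f \<in> borel_measurable (lebesgue_on S)" "AE x in lebesgue_on S. f x = g x"
  shows "integral\<^sup>L (lebesgue_on S) g = integral\<^sup>L (lebesgue_on S) f"
  using borel_measurable_lebesgue_on_AE[OF assms] assms
  by (intro integral_cong_AE) auto

lemma continuous_imp_borel_measurable_lebesgue_on:
  fixes f :: "'a::euclidean_space \<Rightarrow> 'b::euclidean_space"
  assumes "continuous_on UNIV f" and "S \<in> sets lebesgue"
  shows "f \<in> borel_measurable (lebesgue_on S)"
  using assms continuous_imp_measurable_on_sets_lebesgue continuous_on_subset by blast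

lemma continuous_imp_integrable_lebesgue_on_bounded:
  fixes f :: "'a::euclidean_space \<Rightarrow> 'b::euclidean_space"
  assumes f: "continuous_on UNIV f" and S: "bounded S" "S \<in> sets lebesgue"
  shows "integrable (lebesgue_on S) f"
proof -
  have "compact (f ` closure S)"
    using S by (intro compact_continuous_image continuous_on_subset[OF f]) auto
  then obtain B where "\<forall>y\<in>f ` closure S. norm y \<le> B"
    using compact_imp_bounded bounded_iff by blast
  then have B: "norm (f x) \<le> B" if "x \<in> S" for x
    using that closure_subset by blast
  interpret finite_measure "lebesgue_on S"
    using S by (simp add: bounded_set_imp_lmeasurable finite_measure_lebesgue_on)
  show ?thesis
  proof (rule integrable_const_bound)
    show "AE x in lebesgue_on S. norm (f x) \<le> B"
      using B by (intro AE_I2) (simp add: space_restrict_space)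
  qed (rule continuous_imp_borel_measurable_lebesgue_on[OF f S(2)])
qed

section \<open>Box bumps and the fundamental lemma of the calculus of variations\<close>

lemma test_functionsD:
  assumes "\<phi> \<in> test_functions U"
  shows "continuous_on UNIV \<phi>"
    and "(\<phi> has_derivative frechet_derivative \<phi> (at x)) (at x)"
    and "continuous_on UNIV (\<lambda>x. frechet_derivative \<phi> (at x) (axis i 1))"
proof -
  have s: "times_cont_diff k \<phi>" for k
    using assms by (simp add: test_functions_def)
  show "continuous_on UNIV \<phi>" using s[of 0] by simp
  show "(\<phi> has_derivative frechet_derivative \<phi> (at x)) (at x)"
    by (rule times_cont_diff_has_derivative[OF s[of "Suc 0"]])
  show "continuous_on UNIV (\<lambda>x. frechet_derivative \<phi> (at x) (axis i 1))"
    using s[of "Suc 0"] by (simp only: times_cont_diff.simps)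
qed

text \<open>A product over the two coordinates that is positive exactly in the open box, so its
  support lies in the closed box.\<close>

definition box_bump :: "real \<Rightarrow> real^2 \<Rightarrow> real^2 \<Rightarrow> real^2 \<Rightarrow> real" where
  "box_bump s a b x = (\<Prod>j\<in>UNIV. exp_flat s 0 (x $ j - a $ j) * exp_flat s 0 (b $ j - x $ j))"

lemma box_bump_in_test_functions:
  assumes s: "s > 0" and ab: "cbox a b \<subseteq> U"
  shows "box_bump s a b \<in> test_functions U"
proof -
  have "times_cont_diff k (\<lambda>x. exp_flat s 0 (x $ j - a $ j))"
    "times_cont_diff k (\<lambda>x. exp_flat s 0 (b $ j - x $ j))" for k j
    using times_cont_diff_exp_flat[OF s, of k 0 1 j "- a $ j"]
      times_cont_diff_exp_flat[OF s, of k 0 "- 1" j "b $ j"] by simp_all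
  then have "times_cont_diff k (box_bump s a b)" for k
    unfolding box_bump_def[abs_def] UNIV_2 by (simp add: times_cont_diff_mult)
  moreover have "box_bump s a b x = 0" if xab: "x \<notin> cbox a b" for x
  proof -
    obtain j where "\<not> (a $ j \<le> x $ j \<and> x $ j \<le> b $ j)"
      using xab unfolding mem_box_cart by blast
    then show ?thesis
      unfolding box_bump_def by (intro prod_zero bexI[of _ j]) (auto simp: exp_flat_def)
  qed
  ultimately show ?thesis
    unfolding test_functions_def using ab by (auto intro!: exI[of _ "cbox a b"])
qed

lemma box_bump_bound: "s > 0 \<Longrightarrow> \<bar>box_bump s a b x\<bar> \<le> 1"
proof -
  assume s: "s > 0"
  have "0 \<le> exp_flat s 0 t \<and> exp_flat s 0 t \<le> 1" for t
    using s by (simp add: exp_flat_def)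
  then show ?thesis unfolding box_bump_def abs_prod
    by (intro prod_le_1) (simp add: abs_mult mult_le_one)
qed

text \<open>For fixed \<open>t > 0\<close>, \<open>exp (- s / t)\<close> tends to 1 as
  \<open>s\<close> tends to 0, and for \<open>t \<le> 0\<close> the value stays 0; on the faces of
  the box the limit is thus 0, as for the open box.\<close>

lemma box_bump_tendsto: "(\<lambda>n. box_bump (1 / real (Suc n)) a b x) \<longlonglongrightarrow> indicator (box a b) x"
proof -
  have lim: "(\<lambda>n. exp_flat (1 / real (Suc n)) 0 t) \<longlonglongrightarrow> (if t > 0 then 1 else 0)" for t
  proof (cases "t > 0")
    case True
    have "(\<lambda>n. exp (- (1 / real (Suc n)) / t)) \<longlonglongrightarrow> exp (- 0 / t)"
      using True by (intro tendsto_intros LIMSEQ_inverse_real_of_nat[unfolded inverse_eq_divide]) auto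
    then show ?thesis using True by (simp add: exp_flat_def)
  qed (simp add: exp_flat_def)
  have "(\<Prod>j\<in>UNIV. (if x $ j - a $ j > 0 then 1 else 0) * (if b $ j - x $ j > 0 then 1 else 0))
      = (indicator (box a b) x :: real)"
    by (auto simp: UNIV_2 indicator_def mem_box_cart forall_2)
  moreover have "(\<lambda>n. box_bump (1 / real (Suc n)) a b x) \<longlonglongrightarrow>
      (\<Prod>j\<in>UNIV. (if x $ j - a $ j > 0 then 1 else 0) * (if b $ j - x $ j > 0 then 1 else 0))"
    unfolding box_bump_def by (intro tendsto_prod tendsto_mult lim)
  ultimately show ?thesis by simp
qed

text \<open>Box bumps, dominated through \<open>norm (h x)\<close>, give zero integrals over all
  boxes whose closed box lies in \<open>U\<close>. The whole-space lemma then applies to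
  \<open>h\<close> cut off to one such box, and countably many of them cover
  \<open>U\<close>.\<close>

lemma AE_zero_if_test_integrals_zero:
  assumes U: "open U" and h: "integrable (lebesgue_on U) h"
    and zero: "\<And>\<phi>. \<phi> \<in> test_functions U \<Longrightarrow> (LINT x|lebesgue_on U. h x * \<phi> x) = 0"
  shows "AE x in lebesgue_on U. h x = 0"
proof -
  have U': "U \<in> sets lebesgue"
    using U borel_open sets_completionI_sets sets_lborel by metis
  have box0: "(LINT x|lebesgue. indicator (box a b) x * h x) = 0" if ab: "cbox a b \<subseteq> U" for a b
  proof -
    let ?s = "\<lambda>n. 1 / real (Suc n)"
    have "(\<lambda>n. LINT x|lebesgue_on U. h x * box_bump (?s n) a b x)
        \<longlonglongrightarrow> (LINT x|lebesgue_on U. h x * indicator (box a b) x)"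
    proof (rule integral_dominated_convergence)
      show "integrable (lebesgue_on U) (\<lambda>x. norm (h x))" using h by simp
      have "box_bump (?s n) a b \<in> borel_measurable (lebesgue_on U)" for n
        using U' test_functionsD(1)[OF box_bump_in_test_functions[OF _ ab]]
        by (intro continuous_imp_borel_measurable_lebesgue_on) auto
      then show "(\<lambda>x. h x * box_bump (?s n) a b x) \<in> borel_measurable (lebesgue_on U)" for n
        using h by (intro borel_measurable_times) auto
      have "box a b \<in> sets lebesgue" by simp
      then have "indicator (box a b) \<in> borel_measurable (lebesgue_on U)"
        by (intro measurable_restrict_space1 borel_measurable_indicator)
      then show "(\<lambda>x. h x * indicator (box a b) x) \<in> borel_measurable (lebesgue_on U)"
        using h by (intro borel_measurable_times) auto
      show "AE x in lebesgue_on U. (\<lambda>n. h x * box_bump (?s n) a b x) \<longlonglongrightarrow> h x * indicator (box a b) x"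
        by (intro AE_I2 tendsto_mult tendsto_const box_bump_tendsto)
      show "AE x in lebesgue_on U. norm (h x * box_bump (?s n) a b x) \<le> norm (h x)" for n
        by (intro AE_I2) (simp add: abs_mult mult_left_le box_bump_bound del: of_nat_Suc)
    qed
    moreover have "(LINT x|lebesgue_on U. h x * box_bump (?s n) a b x) = 0" for n
      by (intro zero box_bump_in_test_functions ab) simp
    ultimately have "(LINT x|lebesgue_on U. h x * indicator (box a b) x) = 0"
      using LIMSEQ_unique[OF tendsto_const] by fastforce
    also have "(LINT x|lebesgue_on U. h x * indicator (box a b) x)
        = (LINT x|lebesgue. indicator U x *\<^sub>R (h x * indicator (box a b) x))"
      using U' by (intro integral_restrict_space) simp
    also have "\<dots> = (LINT x|lebesgue. indicator (box a b) x * h x)"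
      using ab box_subset_cbox[of a b]
      by (intro Bochner_Integration.integral_cong) (auto simp: indicator_def)
    finally show ?thesis .
  qed
  \<comment> \<open>Outside \<open>U\<close> nothing is known about \<open>h\<close>, so it is
    multiplied by the indicator of \<open>box c d\<close>; integrals of the product over arbitrary
    boxes are integrals of \<open>h\<close> over intersections, which are boxes again.\<close>
  have local: "AE x in lebesgue. x \<in> cbox c d \<longrightarrow> h x = 0" if cd: "cbox c d \<subseteq> U" for c d
  proof -
    have "integrable lebesgue (\<lambda>x. indicator U x *\<^sub>R h x)"
      using h U' by (simp add: integrable_restrict_space)
    then have "integrable lebesgue (\<lambda>x. indicator (box c d) x *\<^sub>R (indicator U x *\<^sub>R h x))"
      by (rule integrable_mult_indicator[rotated]) simp
    moreover have "(\<lambda>x. indicator (box c d) x *\<^sub>R (indicator U x *\<^sub>R h x)) = (\<lambda>x. indicator (box c d) x * h x)"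
      using cd box_subset_cbox[of c d] by (auto simp: fun_eq_iff indicator_def)
    ultimately have "integrable lebesgue (\<lambda>x. indicator (box c d) x * h x)"
      by simp
    moreover have "(LINT x|lebesgue. indicator (box a b) x * (indicator (box c d) x * h x)) = 0" for a b
    proof -
      obtain a' b' where ab': "box a b \<inter> box c d = box a' b'"
        by (simp add: box_Int_box)
      have "(LINT x|lebesgue. indicator (box a' b') x * h x) = 0"
      \<comment> \<open>For an empty \<open>box a' b'\<close> the equation says nothing about
        \<open>cbox a' b'\<close>; otherwise the closed box is the closure of the open one and stays
        in \<open>cbox c d\<close>.\<close>
      proof (cases "box a' b' = {}")
        case False
        then have "cbox a' b' \<subseteq> cbox c d"
          using ab' by (metis Int_lower2 closure_box closure_minimal closed_cbox box_subset_cbox order_trans)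
        then show ?thesis using box0 cd by blast
      qed simp
      then show ?thesis
        by (simp add: ab'[symmetric] indicator_inter_arith mult.assoc)
    qed
    ultimately have "AE x in lebesgue. indicator (box c d) x * h x = 0"
      by (rule AE_zero_if_box_integrals_zero)
    \<comment> \<open>The cover below consists of closed boxes, whose faces form a null set.\<close>
    moreover have "AE x in lebesgue. x \<notin> cbox c d - box c d"
      using negligible_frontier_interval by (intro AE_not_in) (auto simp: negligible_iff_null_sets)
    ultimately show ?thesis
      by eventually_elim (auto simp: indicator_def split: if_splits)
  qed
  obtain \<D> where D: "countable \<D>" "\<And>X. X \<in> \<D> \<Longrightarrow> X \<subseteq> U \<and> (\<exists>c d. X = cbox c d)" "\<Union>\<D> = U"
    using open_countable_Union_open_cbox[OF U] by (metis PowD subsetD)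
  have "AE x in lebesgue. \<forall>X\<in>\<D>. x \<in> X \<longrightarrow> h x = 0"
    unfolding AE_ball_countable[OF D(1)]
  proof
    fix X assume "X \<in> \<D>"
    then obtain c d where "X = cbox c d" "cbox c d \<subseteq> U" using D(2) by metis
    then show "AE x in lebesgue. x \<in> X \<longrightarrow> h x = 0" using local by simp
  qed
  then have "AE x in lebesgue. x \<in> U \<longrightarrow> h x = 0"
    by eventually_elim (use D in auto)
  then show ?thesis using U' by (simp add: AE_restrict_space_iff)
qed

section \<open>Uniqueness of weak gradients and the classical case\<close>

lemma square_integrable_component_integrable:
  fixes g :: "real^2 \<Rightarrow> real^2"
  assumes g: "square_integrable U g" and U: "U \<in> lmeasurable"
  shows "integrable (lebesgue_on U) (\<lambda>x. g x $ i)"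
proof -
  interpret finite_measure "lebesgue_on U" using U by (rule finite_measure_lebesgue_on)
  have gm: "g \<in> borel_measurable (lebesgue_on U)" and gi: "integrable (lebesgue_on U) (\<lambda>x. (norm (g x))\<^sup>2)"
    using g by (auto simp: square_integrable_def)
  \<comment> \<open>On a set of finite measure \<open>1 + (norm (g x))\<^sup>2\<close> is
    integrable, and it bounds \<open>norm (g x)\<close>, hence each component.\<close>
  have "integrable (lebesgue_on U) (\<lambda>x. 1 + (norm (g x))\<^sup>2)"
    using gi by simp
  then show ?thesis
  proof (rule Bochner_Integration.integrable_bound)
    show "(\<lambda>x. g x $ i) \<in> borel_measurable (lebesgue_on U)"
      using gm by (simp add: cart_eq_inner_axis)
    have "\<bar>g x $ i\<bar> \<le> 1 + (norm (g x))\<^sup>2" for x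
    proof -
      have "\<bar>g x $ i\<bar> \<le> norm (g x)" by (rule component_le_norm_cart)
      also have "\<dots> \<le> 1 + (norm (g x))\<^sup>2"
        using sum_squares_bound[of 1 "norm (g x)"] by (simp add: power2_eq_square) (smt (verit) norm_ge_zero)
      finally show ?thesis .
    qed
    then show "AE x in lebesgue_on U. norm (g x $ i) \<le> norm (1 + (norm (g x))\<^sup>2)"
      by (intro AE_I2) (simp add: abs_of_nonneg add_nonneg_nonneg)
  qed
qed

lemma integrable_mult_test_function:
  assumes g: "integrable (lebesgue_on U) g" and U: "U \<in> sets lebesgue" and \<phi>: "\<phi> \<in> test_functions U"
  shows "integrable (lebesgue_on U) (\<lambda>x. g x * \<phi> x :: real)"
proof -
  obtain K where K: "compact K" "\<And>x. x \<notin> K \<Longrightarrow> \<phi> x = 0"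
    using \<phi> by (auto simp: test_functions_def)
  have "compact (\<phi> ` K)"
    using K test_functionsD(1)[OF \<phi>] by (meson compact_continuous_image continuous_on_subset subset_UNIV)
  then obtain B where "\<And>x. x \<in> K \<Longrightarrow> \<bar>\<phi> x\<bar> \<le> B"
    by (metis bounded_iff compact_imp_bounded imageI real_norm_def)
  then have B: "\<bar>\<phi> x\<bar> \<le> max 0 B" for x
    using K(2) by (cases "x \<in> K") (auto simp: le_max_iff_disj)
  have "integrable (lebesgue_on U) (\<lambda>x. max 0 B * norm (g x))" using g by simp
  then show ?thesis
  proof (rule Bochner_Integration.integrable_bound)
    show "(\<lambda>x. g x * \<phi> x) \<in> borel_measurable (lebesgue_on U)"
      using g continuous_imp_borel_measurable_lebesgue_on[OF test_functionsD(1)[OF \<phi>] U]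
      by (intro borel_measurable_times) auto
    show "AE x in lebesgue_on U. norm (g x * \<phi> x) \<le> norm (max 0 B * norm (g x))"
      using B by (intro AE_I2) (simp add: abs_mult mult.commute[of "\<bar>g _\<bar>"] mult_right_mono)
  qed
qed

text \<open>Both gradients have the same integrals against every test function, so the fundamental
  lemma applies to each component of their difference. Boundedness of \<open>U\<close> makes the
  components integrable.\<close>

lemma is_weak_gradient_unique:
  assumes U: "open U" "bounded U" and g: "is_weak_gradient U v g" and g': "is_weak_gradient U v g'"
  shows "AE x in lebesgue_on U. g x = g' x"
proof -
  have Um: "U \<in> lmeasurable" using U by (simp add: bounded_set_imp_lmeasurable)
  have "AE x in lebesgue_on U. g x $ i - g' x $ i = 0" for i
  proof (rule AE_zero_if_test_integrals_zero[OF U(1)])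
    have int: "integrable (lebesgue_on U) (\<lambda>x. g x $ i)" "integrable (lebesgue_on U) (\<lambda>x. g' x $ i)"
      using g g' Um by (auto simp: is_weak_gradient_def intro: square_integrable_component_integrable)
    then show "integrable (lebesgue_on U) (\<lambda>x. g x $ i - g' x $ i)" by simp
    fix \<phi> assume \<phi>: "\<phi> \<in> test_functions U"
    have "(LINT x|lebesgue_on U. g x $ i * \<phi> x) = (LINT x|lebesgue_on U. g' x $ i * \<phi> x)"
      using g[unfolded is_weak_gradient_def, THEN conjunct2, rule_format, OF \<phi>, of i]
        g'[unfolded is_weak_gradient_def, THEN conjunct2, rule_format, OF \<phi>, of i] by simp
    then show "(LINT x|lebesgue_on U. (g x $ i - g' x $ i) * \<phi> x) = 0"
      using int[THEN integrable_mult_test_function[OF _ _ \<phi>]] Um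
      by (simp add: left_diff_distrib fmeasurableD)
  qed
  then have "AE x in lebesgue_on U. \<forall>i\<in>UNIV. g x $ i - g' x $ i = 0"
    by (subst AE_finite_all) auto
  then show ?thesis by eventually_elim (auto simp: vec_eq_iff)
qed

text \<open>Integration by parts: the product of \<open>q\<close> and a test function has compact
  support, so its partial derivatives integrate to 0, and the product rule splits these into the two
  required terms.\<close>

lemma classical_gradient_is_weak_gradient:
  assumes U: "open U" "bounded U"
    and q: "\<And>x. (q has_derivative (\<lambda>h. G x \<bullet> h)) (at x)" and G: "continuous_on UNIV G"
    and vq: "AE x in lebesgue_on U. v x = q x"
  shows "is_weak_gradient U v G"
proof -
  have U': "U \<in> sets lebesgue"
    using U borel_open sets_completionI_sets sets_lborel by metis
  have qc: "continuous_on UNIV q"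
    using has_derivative_continuous[OF q] by (auto intro!: continuous_at_imp_continuous_on)
  have sq: "square_integrable U G"
    unfolding square_integrable_def using G U U'
    by (auto intro!: continuous_imp_borel_measurable_lebesgue_on
        continuous_imp_integrable_lebesgue_on_bounded continuous_intros)
  have "(LINT x|lebesgue_on U. v x * frechet_derivative \<phi> (at x) (axis i 1))
      = - (LINT x|lebesgue_on U. G x $ i * \<phi> x)" if \<phi>: "\<phi> \<in> test_functions U" for \<phi> i
  proof -
    note \<phi>D = test_functionsD[OF \<phi>]
    define D where "D = (\<lambda>x. frechet_derivative \<phi> (at x) (axis i 1))"
    have Dc: "continuous_on UNIV D" unfolding D_def by (rule \<phi>D(3))
    obtain K where K: "compact K" "K \<subseteq> U" "\<And>x. x \<notin> K \<Longrightarrow> \<phi> x = 0"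
      using \<phi> by (auto simp: test_functions_def)
    let ?F' = "\<lambda>x h. q x * frechet_derivative \<phi> (at x) h + (G x \<bullet> h) * \<phi> x"
    have F': "((\<lambda>x. q x * \<phi> x) has_derivative ?F' x) (at x)" for x
      by (rule has_derivative_mult[OF q \<phi>D(2)])
    have F'_i: "?F' x (axis i 1) = q x * D x + G x $ i * \<phi> x" for x
      by (simp add: D_def cart_eq_inner_axis)
    have F'c: "continuous_on UNIV (\<lambda>x. q x * D x + G x $ i * \<phi> x)"
      using qc Dc G \<phi>D(1) by (intro continuous_intros)
    have D0: "D x = 0" if "x \<notin> K" for x
      unfolding D_def using has_derivative_eq_0_outside[OF K(1,3) \<phi>D(2) that] .
    \<comment> \<open>The integrand vanishes off \<open>U\<close>, which turns the integral over
      \<open>U\<close> into one over the plane, where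
      \<open>integral_directional_derivative_eq_0\<close> applies.\<close>
    have z: "q x * D x + G x $ i * \<phi> x = 0" if "x \<notin> U" for x
    proof -
      have "x \<notin> K" using that K(2) by blast
      then show ?thesis using K(3) D0 by simp
    qed
    have "(LINT x|lebesgue_on U. q x * D x + G x $ i * \<phi> x)
        = (LINT x|lebesgue. indicator U x *\<^sub>R (q x * D x + G x $ i * \<phi> x))"
      using U' by (intro integral_restrict_space) simp
    also have "\<dots> = (LINT x|lebesgue. q x * D x + G x $ i * \<phi> x)"
      by (intro Bochner_Integration.integral_cong) (auto simp: indicator_def z)
    also have "\<dots> = (LINT x|lborel. q x * D x + G x $ i * \<phi> x)"
      using F'c by (intro integral_completion) (simp add: borel_measurable_continuous_onI)
    also have "\<dots> = 0"
      using integral_directional_derivative_eq_0[OF K(1) _ F', of "axis i 1"] K(3) F'c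
      by (simp add: F'_i)
    finally have "(LINT x|lebesgue_on U. q x * D x) + (LINT x|lebesgue_on U. G x $ i * \<phi> x) = 0"
      using qc Dc G \<phi>D(1) U U'
      by (subst (asm) Bochner_Integration.integral_add)
        (auto intro!: continuous_imp_integrable_lebesgue_on_bounded continuous_intros)
    moreover have "(LINT x|lebesgue_on U. v x * D x) = (LINT x|lebesgue_on U. q x * D x)"
    proof (rule integral_cong_AE_lebesgue_on[OF U'])
      show "(\<lambda>x. q x * D x) \<in> borel_measurable (lebesgue_on U)"
        using qc Dc U' by (intro continuous_imp_borel_measurable_lebesgue_on continuous_intros)
      show "AE x in lebesgue_on U. q x * D x = v x * D x"
        using vq by eventually_elim simp
    qed
    ultimately show ?thesis by (simp add: D_def)
  qed
  with sq show ?thesis by (simp add: is_weak_gradient_def)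
qed

text \<open>Since a weak gradient exists, the choice \<open>weak_gradient\<close> is one, and
  uniqueness identifies it with \<open>G\<close>.\<close>

lemma weak_gradient_AE_eq_classical:
  assumes "open U" "bounded U"
    and "\<And>x. (q has_derivative (\<lambda>h. G x \<bullet> h)) (at x)" and "continuous_on UNIV G"
    and "AE x in lebesgue_on U. v x = q x"
  shows "AE x in lebesgue_on U. weak_gradient U v x = G x"
proof -
  have "is_weak_gradient U v G"
    by (rule classical_gradient_is_weak_gradient[OF assms])
  moreover from this have "is_weak_gradient U v (weak_gradient U v)"
    unfolding weak_gradient_def by (rule someI[where P="is_weak_gradient U v"])
  ultimately show ?thesis using is_weak_gradient_unique assms by blast
qed

section \<open>Quadratic polynomials on a triangle\<close>

lemma polynomials_1D:
  assumes "q \<in> polynomials 1"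
  shows "\<exists>k g. \<forall>x. q x = k + g \<bullet> x"
proof -
  obtain c where c: "\<And>x. q x = (\<Sum>i\<le>1. \<Sum>j\<le>1-i. c i j * (x $ 1) ^ i * (x $ 2) ^ j)"
    using assms unfolding polynomials_def by blast
  have "q x = c 0 0 + vector [c 1 0, c 0 1] \<bullet> x" for x
    by (simp add: c inner_vec_def sum_2 algebra_simps)
  then show ?thesis by blast
qed

text \<open>The coordinate-free form with a self-adjoint quadratic part lets gradients and edge
  integrals be computed with inner products alone.\<close>

lemma polynomials_2D:
  assumes "q \<in> polynomials 2"
  shows "\<exists>k g A. linear A \<and> (\<forall>x y. A x \<bullet> y = x \<bullet> A y) \<and> (\<forall>x. q x = k + g \<bullet> x + x \<bullet> A x)"
proof -
  obtain c where c: "\<And>x. q x = (\<Sum>i\<le>2. \<Sum>j\<le>2-i. c i j * (x $ 1) ^ i * (x $ 2) ^ j)"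
    using assms unfolding polynomials_def by blast
  \<comment> \<open>The mixed coefficient is split evenly between the off-diagonal entries, which
    makes \<open>A\<close> symmetric.\<close>
  define A :: "real^2 \<Rightarrow> real^2" where
    "A x = vector [c 2 0 * x $ 1 + c 1 1 / 2 * x $ 2, c 1 1 / 2 * x $ 1 + c 0 2 * x $ 2]" for x
  have "linear A"
    by (rule linearI) (simp_all add: A_def vec_eq_iff forall_2 algebra_simps add_divide_distrib)
  moreover have "A x \<bullet> y = x \<bullet> A y" for x y
    by (simp add: A_def inner_vec_def sum_2 algebra_simps)
  moreover have "q x = c 0 0 + vector [c 1 0, c 0 1] \<bullet> x + x \<bullet> A x" for x
    by (simp add: c A_def inner_vec_def sum_2 numeral_2_eq_2 field_simps)
  ultimately show ?thesis by blast
qed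

lemma quadratic_has_gradient:
  fixes A :: "'a::euclidean_space \<Rightarrow> 'a"
  assumes A: "linear A" "\<And>x y. A x \<bullet> y = x \<bullet> A y"
  shows "((\<lambda>x. k + g \<bullet> x + x \<bullet> A x) has_derivative (\<lambda>h. (g + 2 *\<^sub>R A x) \<bullet> h)) (at x)"
proof -
  have "(A has_derivative A) (at x)" using A(1) by (rule linear_imp_has_derivative)
  then have "((\<lambda>x. k + g \<bullet> x + x \<bullet> A x) has_derivative (\<lambda>h. g \<bullet> h + (x \<bullet> A h + h \<bullet> A x))) (at x)"
    by (auto intro!: derivative_eq_intros)
  moreover have "g \<bullet> h + (x \<bullet> A h + h \<bullet> A x) = (g + 2 *\<^sub>R A x) \<bullet> h" for h
    using A(2)[of x h] inner_commute[of h "A x"] by (simp add: inner_add_left)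
  ultimately show ?thesis by simp
qed

text \<open>An edge is a null set, so almost everywhere equality does not by itself determine values
  there. Continuity does: the set of agreement is closed and contains the interior, which is dense
  in the convex set \<open>T\<close>.\<close>

lemma restr_eq:
  assumes T: "convex T" "closed T" "interior T \<noteq> {}"
    and q: "continuous_on UNIV q" and vq: "AE x in lebesgue_on T. v x = q x" and "x \<in> T"
  shows "restr v T x = q x"
proof -
  let ?r = "restr v T"
  have "continuous_on T q \<and> (AE x in lebesgue_on T. v x = q x)"
    using q vq continuous_on_subset by blast
  then have "continuous_on T ?r \<and> (AE x in lebesgue_on T. v x = ?r x)"
    unfolding restr_def
    by (rule someI[where P="\<lambda>q. continuous_on T q \<and> (AE x in lebesgue_on T. v x = q x)"])
  then have r: "continuous_on T ?r" and vr: "AE x in lebesgue_on T. v x = ?r x" by auto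
  define Z where "Z = {x \<in> T. ?r x - q x = 0}"
  have "closed Z"
    unfolding Z_def using T(2) r q
    by (intro continuous_closed_preimage_constant continuous_intros) (auto intro: continuous_on_subset)
  have "T \<in> sets lebesgue"
    using T(2) borel_closed sets_completionI_sets sets_lborel by metis
  moreover have "AE x in lebesgue_on T. ?r x = q x"
    using vq vr by eventually_elim simp
  ultimately have "AE x in lebesgue. x \<in> T \<longrightarrow> ?r x = q x"
    by (simp add: AE_restrict_space_iff)
  then have "AE x \<in> interior T in lebesgue. x \<in> Z"
    by eventually_elim (use interior_subset in \<open>auto simp: Z_def\<close>)
  then have "interior T \<subseteq> Z"
    using mem_closed_if_AE_lebesgue_open[OF open_interior \<open>closed Z\<close>] by blast
  then have "closure (interior T) \<subseteq> Z"
    using \<open>closed Z\<close> by (rule closure_minimal)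
  then show ?thesis
    using convex_closure_interior[OF T(1,3)] \<open>x \<in> T\<close> T(2) by (auto simp: Z_def)
qed

text \<open>On the segment the function is a quadratic in \<open>t\<close>; its integral is
  regrouped symmetrically in the end points, so that edges sharing a vertex can be compared.\<close>

lemma integral_linepath_quadratic:
  assumes A: "linear A" "\<And>x y. A x \<bullet> y = x \<bullet> A y"
  shows "((\<lambda>t. k + g \<bullet> linepath a b t + linepath a b t \<bullet> A (linepath a b t)) has_integral
     k + g \<bullet> (a + b) / 2 + (a \<bullet> A a + a \<bullet> A b + b \<bullet> A b) / 3) {0..1}"
proof -
  define d where "d = b - a"
  have b: "b = a + d" by (simp add: d_def)
  define c0 where "c0 = k + g \<bullet> a + a \<bullet> A a"
  define c1 where "c1 = g \<bullet> d + 2 * (a \<bullet> A d)"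
  define c2 where "c2 = d \<bullet> A d"
  have sym: "d \<bullet> A a = a \<bullet> A d" using A(2) by (metis inner_commute)
  have "k + g \<bullet> linepath a b t + linepath a b t \<bullet> A (linepath a b t) = c0 + c1 * t + c2 * t\<^sup>2" for t
  proof -
    have "linepath a b t = a + t *\<^sub>R d"
      by (simp add: linepath_def d_def algebra_simps)
    then show ?thesis
      by (simp add: c0_def c1_def c2_def linear_add[OF A(1)] linear_scale[OF A(1)] sym
          inner_add_left inner_add_right power2_eq_square distrib_left distrib_right)
  qed
  moreover have "((\<lambda>t. c0 + c1 * t + c2 * t\<^sup>2) has_integral
      (c0 * 1 + c1 * 1\<^sup>2 / 2 + c2 * 1 ^ 3 / 3) - (c0 * 0 + c1 * 0\<^sup>2 / 2 + c2 * 0 ^ 3 / 3)) {0..1}"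
    by (intro fundamental_theorem_of_calculus)
      (auto intro!: derivative_eq_intros simp: has_real_derivative_iff_has_vector_derivative[symmetric] power2_eq_square)
  moreover have "c0 + c1 / 2 + c2 / 3 = k + g \<bullet> (a + b) / 2 + (a \<bullet> A a + a \<bullet> A b + b \<bullet> A b) / 3"
    by (simp add: c0_def c1_def c2_def b linear_add[OF A(1)] sym inner_add_left inner_add_right
        add_divide_distrib distrib_left)
  ultimately show ?thesis by simp
qed

section \<open>Centroid and first moment of a triangle\<close>

locale triangle =
  fixes a b c :: "real^2"
  assumes indep: "\<not> affine_dependent {a, b, c}" and dist: "a \<noteq> b" "a \<noteq> c" "b \<noteq> c"
begin

definition "m = (1/3) *\<^sub>R (a + b + c)"

lemma vertices_sum: "(a - m) + (b - m) + (c - m) = 0"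
  by (simp add: m_def vec_eq_iff field_simps)

lemma decompose:
  obtains \<alpha> \<beta> where "x = \<alpha> *\<^sub>R (a - m) + \<beta> *\<^sub>R (b - m)"
proof -
  \<comment> \<open>The vertices being distinct, \<open>{a, b, c}\<close> has three elements, enough
    for an affinely independent set to span the plane.\<close>
  have "affine hull {a, b, c} = UNIV"
    using affine_independent_span_gt[OF indep] dist by simp
  then have "m + x \<in> affine hull {a, b, c}" by simp
  then obtain u v w where uvw: "u + v + w = 1" "m + x = u *\<^sub>R a + v *\<^sub>R b + w *\<^sub>R c"
    unfolding affine_hull_3 by blast
  have "x = u *\<^sub>R a + v *\<^sub>R b + w *\<^sub>R c - (u + v + w) *\<^sub>R m"
    using uvw by (simp add: algebra_simps)
  also have "\<dots> = u *\<^sub>R (a - m) + v *\<^sub>R (b - m) + w *\<^sub>R (c - m)"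
    by (simp add: algebra_simps)
  also have "c - m = - (a - m) - (b - m)" using vertices_sum by (simp add: algebra_simps)
  also have "u *\<^sub>R (a - m) + v *\<^sub>R (b - m) + w *\<^sub>R (- (a - m) - (b - m))
      = (u - w) *\<^sub>R (a - m) + (v - w) *\<^sub>R (b - m)" by (simp add: algebra_simps)
  finally show ?thesis by (rule that)
qed

text \<open>A vector orthogonal to the two sides has the same inner product with
  \<open>a - m\<close>, \<open>b - m\<close> and \<open>c - m\<close>. These vectors sum to 0, so
  all three products vanish, and the first two vectors span the plane.\<close>

lemma eq_0I:
  assumes "x \<bullet> (a - b) = 0" "x \<bullet> (a - c) = 0"
  shows "x = 0"
proof -
  have "x \<bullet> (a - m) + x \<bullet> (b - m) + x \<bullet> (c - m) = 0"
    using vertices_sum by (metis inner_add_right inner_zero_right)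
  then have "x \<bullet> (a - m) = 0" "x \<bullet> (b - m) = 0"
    using assms by (simp_all add: inner_diff_right)
  moreover obtain \<alpha> \<beta> where "x = \<alpha> *\<^sub>R (a - m) + \<beta> *\<^sub>R (b - m)"
    by (rule decompose)
  ultimately have "x \<bullet> x = 0"
    by (metis inner_add_right inner_scaleR_right mult_zero_right add.right_neutral)
  then show ?thesis by simp
qed

text \<open>The affine map about the centroid that permutes the vertices cyclically preserves the
  triangle and its area, so its linear part fixes the first moment.\<close>

lemma integral_diff_centroid_eq_0: "integral (convex hull {a, b, c}) (\<lambda>x. x - m) = 0"
proof -
  let ?T = "convex hull {a, b, c}"
  let ?u = "a - m" and ?v = "b - m" and ?w = "c - m"
  have span: "UNIV \<subseteq> span {?u, ?v}"
  proof
    fix x obtain \<alpha> \<beta> where "x = \<alpha> *\<^sub>R ?u + \<beta> *\<^sub>R ?v" by (rule decompose)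
    then show "x \<in> span {?u, ?v}" by (simp add: span_add span_base span_scale)
  qed
  \<comment> \<open>Two vectors that span the plane form a basis, so the cyclic shift of the
    vertices can be prescribed on \<open>?u\<close> and \<open>?v\<close>; its value at
    \<open>?w\<close> follows from the zero sum.\<close>
  have "independent {?u, ?v}"
    by (rule card_le_dim_spanning[OF _ span]) (auto simp: card_insert_if)
  then obtain A where A: "linear A" "\<forall>x\<in>{?u, ?v}. A x = (if x = ?u then ?v else ?w)"
    using linear_independent_extend[of "{?u, ?v}" "\<lambda>x. if x = ?u then ?v else ?w"] by blast
  have Au: "A ?u = ?v" and Av: "A ?v = ?w" using A(2) dist by auto
  have w: "?w = - ?u - ?v" using vertices_sum by (simp add: algebra_simps)
  have "A ?w = - A ?u - A ?v"
    unfolding w using A(1) by (simp only: linear_diff linear_neg)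
  also have "\<dots> = ?u" unfolding Au Av w by simp
  finally have Aw: "A ?w = ?u" .
  \<comment> \<open>At \<open>?u\<close> and \<open>?v\<close> this is the sum of the three vertex
    vectors, and linearity extends it to the plane.\<close>
  have sum0: "x + A x + A (A x) = 0" for x
  proof -
    obtain \<alpha> \<beta> where x: "x = \<alpha> *\<^sub>R ?u + \<beta> *\<^sub>R ?v" by (rule decompose)
    have "x + A x + A (A x) = \<alpha> *\<^sub>R (?u + ?v + ?w) + \<beta> *\<^sub>R (?u + ?v + ?w)"
      unfolding x linear_add[OF A(1)] linear_scale[OF A(1)] Au Av Aw
      by (simp only: scaleR_add_right add_ac)
    then show ?thesis by (simp only: vertices_sum scaleR_zero_right add_0)
  qed
  \<comment> \<open>Comparing \<open>sum0\<close> at \<open>x\<close> and at \<open>A x\<close>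
    cancels the common terms. The determinant then has cube 1, so the map preserves area.\<close>
  have cube: "A (A (A x)) = x" for x
  proof -
    have "x + (A x + A (A x)) = 0" "A (A (A x)) + (A x + A (A x)) = 0"
      using sum0[of x] sum0[of "A x"] by (simp_all only: add_ac)
    then show ?thesis by (metis add_right_cancel)
  qed
  have "matrix (A \<circ> (A \<circ> A)) = matrix A ** (matrix A ** matrix A)"
    using A(1) linear_compose[OF A(1) A(1)] by (simp add: matrix_compose)
  moreover have "A \<circ> (A \<circ> A) = id" using cube by auto
  ultimately have "matrix A ** (matrix A ** matrix A) = mat 1"
    by (simp add: matrix_id_mat_1 flip: id_def)
  then have "det (matrix A ** (matrix A ** matrix A)) = 1"
    by simp
  then have "\<bar>det (matrix A)\<bar> ^ 3 = 1 ^ 3"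
    by (metis abs_1 det_mul mult.assoc power3_eq_cube power_abs power_one)
  then have det: "\<bar>det (matrix A)\<bar> = 1"
    by (rule power_eq_imp_eq_base) auto
  define R where "R x = m + A (x - m)" for x
  have "inj R"
  proof (rule injI)
    fix x y assume "R x = R y"
    then have "A (x - m) = A (y - m)" by (simp add: R_def)
    then have "A (A (A (x - m))) = A (A (A (y - m)))" by simp
    then show "x = y" by (simp add: cube)
  qed
  have R': "(R has_derivative A) (at x within S)" for x S
    unfolding R_def by (auto intro!: derivative_eq_intros has_derivative_compose[OF _ linear_imp_has_derivative[OF A(1)]])
  have "?T = (+) m ` (convex hull {?u, ?v, ?w})"
    unfolding convex_hull_translation[symmetric] by simp
  moreover have "A ` (convex hull {?u, ?v, ?w}) = convex hull {?u, ?v, ?w}"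
    unfolding convex_hull_linear_image[OF A(1)] using Au Av Aw by (simp add: insert_commute)
  moreover have "R ` (+) m ` X = (+) m ` A ` X" for X
    by (simp add: image_image R_def)
  ultimately have RT: "R ` ?T = ?T" by metis
  have Tc: "compact ?T" by (simp add: finite_imp_compact_convex_hull)
  then have Tm: "?T \<in> sets lebesgue" by (simp add: fmeasurableD lmeasurable_compact)
  have abs: "(\<lambda>x. x - m) absolutely_integrable_on ?T"
    using continuous_imp_integrable_lebesgue_on_bounded[of "\<lambda>x. x - m" ?T] compact_imp_bounded[OF Tc] Tm
    by (simp add: set_integrable_def integrable_restrict_space continuous_on_diff)
  have "integral ?T (\<lambda>x. x - m) = integral ?T (\<lambda>x. \<bar>det (matrix A)\<bar> *\<^sub>R (R x - m))"
    using integral_change_of_variables[OF Tm R' inj_on_subset[OF \<open>inj R\<close>], of "\<lambda>x. x - m"] abs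
    by (simp add: RT)
  also have "\<dots> = integral ?T (A \<circ> (\<lambda>x. x - m))"
    by (simp add: det R_def o_def)
  also have "\<dots> = A (integral ?T (\<lambda>x. x - m))"
    using abs A(1) by (intro integral_linear) (auto simp: linear_linear set_lebesgue_integral_eq_integral(1))
  finally have "integral ?T (\<lambda>x. x - m) = A (integral ?T (\<lambda>x. x - m))" .
  \<comment> \<open>With the moment fixed by \<open>A\<close>, the three terms of
    \<open>sum0\<close> coincide, so three times the moment is 0.\<close>
  with sum0 have "integral ?T (\<lambda>x. x - m) + integral ?T (\<lambda>x. x - m) + integral ?T (\<lambda>x. x - m) = 0"
    by metis
  then show ?thesis by (simp add: vec_eq_iff)
qed

end

text \<open>Subtracting the mean formulas of two edges leaves half the derivative at the centroid
  along the side joining their free ends; two such sides determine the gradient there.\<close>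

lemma triangle_gradient_orthogonal:
  fixes a b c g p :: "real^2"
  assumes indep: "\<not> affine_dependent {a, b, c}" and dist: "a \<noteq> b" "a \<noteq> c" "b \<noteq> c"
    and A: "linear A" "\<And>x y. A x \<bullet> y = x \<bullet> A y"
    and r: "\<And>x. r x = k + g \<bullet> x + x \<bullet> A x"
    and edges: "integral {0..1} (\<lambda>t. r (linepath a b t)) = 0"
      "integral {0..1} (\<lambda>t. r (linepath a c t)) = 0"
      "integral {0..1} (\<lambda>t. r (linepath b c t)) = 0"
  shows "(LINT x|lebesgue_on (convex hull {a, b, c}). p \<bullet> (g + 2 *\<^sub>R A x)) = 0"
proof -
  interpret triangle a b c by standard fact+
  let ?T = "convex hull {a, b, c}"
  have mean: "k + g \<bullet> (x + y) / 2 + (x \<bullet> A x + x \<bullet> A y + y \<bullet> A y) / 3 = 0"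
    if "integral {0..1} (\<lambda>t. r (linepath x y t)) = 0" for x y
    using that integral_unique[OF integral_linepath_quadratic[OF A]] unfolding r by metis
  have sym: "y \<bullet> A x = x \<bullet> A y" for x y using A(2) by (metis inner_commute)
  have Am: "x \<bullet> A m = (x \<bullet> A a + x \<bullet> A b + x \<bullet> A c) / 3" for x
    unfolding m_def by (simp add: linear_add[OF A(1)] linear_scale[OF A(1)] inner_add_right)
  have G0: "g + 2 *\<^sub>R A m = 0"
  proof (rule eq_0I)
    have swap: "(g + 2 *\<^sub>R A m) \<bullet> z = g \<bullet> z + 2 * (z \<bullet> A m)" for z
      by (simp add: inner_add_left inner_commute[of "A m"])
    show "(g + 2 *\<^sub>R A m) \<bullet> (a - b) = 0"
      unfolding swap using mean[OF edges(2)] mean[OF edges(3)] sym[of b a] sym[of c a] sym[of c b]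
      by (simp add: Am inner_add_right inner_diff_right inner_diff_left field_simps)
    show "(g + 2 *\<^sub>R A m) \<bullet> (a - c) = 0"
      unfolding swap using mean[OF edges(1)] mean[OF edges(3)] sym[of b a] sym[of c a] sym[of c b]
      by (simp add: Am inner_add_right inner_diff_right inner_diff_left field_simps)
  qed
  \<comment> \<open>Since the gradient vanishes at \<open>m\<close>, it is linear in
    \<open>x - m\<close>; symmetry moves \<open>A\<close> to \<open>p\<close>, leaving a constant
    vector against the first moment.\<close>
  have lin: "p \<bullet> (g + 2 *\<^sub>R A x) = (2 *\<^sub>R A p) \<bullet> (x - m)" for x
  proof -
    have "g + 2 *\<^sub>R A x = 2 *\<^sub>R A (x - m)"
      using G0 by (simp add: linear_diff[OF A(1)] scaleR_diff_right add_eq_0_iff)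
    then show ?thesis using A(2)[of p "x - m"] by simp
  qed
  have Tc: "compact ?T" by (simp add: finite_imp_compact_convex_hull)
  then have Tm: "?T \<in> sets lebesgue" by (simp add: fmeasurableD lmeasurable_compact)
  have int: "integrable (lebesgue_on ?T) (\<lambda>x. x - m)"
    using compact_imp_bounded[OF Tc] Tm
    by (intro continuous_imp_integrable_lebesgue_on_bounded continuous_intros)
  have "(LINT x|lebesgue_on ?T. p \<bullet> (g + 2 *\<^sub>R A x)) = (2 *\<^sub>R A p) \<bullet> (LINT x|lebesgue_on ?T. x - m)"
    unfolding lin using int by (intro integral_inner_right) simp
  also have "(LINT x|lebesgue_on ?T. x - m) = 0"
    using lebesgue_integral_eq_integral[OF int Tm] integral_diff_centroid_eq_0 by simp
  finally show ?thesis by simp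
qed

section \<open>Orthogonality on one triangle of the mesh\<close>

lemma AE_lebesgue_on_subset:
  assumes "AE x in lebesgue_on T. P x" "T \<in> sets lebesgue" "U \<in> sets lebesgue" "U \<subseteq> T"
  shows "AE x in lebesgue_on U. P x"
proof -
  have "AE x in lebesgue. x \<in> T \<longrightarrow> P x"
    using assms by (simp add: AE_restrict_space_iff)
  then have "AE x in lebesgue. x \<in> U \<longrightarrow> P x"
    by eventually_elim (use assms(4) in auto)
  then show ?thesis using assms by (simp add: AE_restrict_space_iff)
qed

text \<open>The frontier of a convex set is a null set, so what holds almost everywhere on the
  interior holds almost everywhere on \<open>T\<close>. Taking \<open>A\<close> to be 0 covers
  affine functions too.\<close>

lemma weak_gradient_interior_AE:
  assumes T: "convex T" "compact T" and A: "linear A" "\<And>x y. A x \<bullet> y = x \<bullet> A y"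
    and v: "AE x in lebesgue_on T. v x = k + g \<bullet> x + x \<bullet> A x"
  shows "AE x in lebesgue_on T. weak_gradient (interior T) v x = g + 2 *\<^sub>R A x"
proof -
  let ?U = "interior T"
  have Tm: "T \<in> sets lebesgue" and Um: "?U \<in> sets lebesgue"
    using T by (auto simp: fmeasurableD lmeasurable_compact lmeasurable_interior compact_imp_bounded)
  have "AE x in lebesgue_on ?U. weak_gradient ?U v x = g + 2 *\<^sub>R A x"
  proof (rule weak_gradient_AE_eq_classical)
    show "bounded ?U" using T compact_imp_bounded bounded_interior by blast
    show "continuous_on UNIV (\<lambda>x. g + 2 *\<^sub>R A x)"
      using linear_continuous_on[of A] A(1) by (intro continuous_intros) (simp add: linear_linear)
    show "AE x in lebesgue_on ?U. v x = k + g \<bullet> x + x \<bullet> A x"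
      using AE_lebesgue_on_subset[OF v Tm Um interior_subset] .
  qed (use quadratic_has_gradient[OF A] in auto)
  then have "AE x in lebesgue. x \<in> ?U \<longrightarrow> weak_gradient ?U v x = g + 2 *\<^sub>R A x"
    using Um by (simp add: AE_restrict_space_iff)
  moreover have "AE x in lebesgue. x \<notin> frontier T"
    using negligible_convex_frontier[OF T(1)] by (intro AE_not_in) (simp add: negligible_iff_null_sets)
  ultimately have "AE x in lebesgue. x \<in> T \<longrightarrow> weak_gradient ?U v x = g + 2 *\<^sub>R A x"
    by eventually_elim (use closure_subset in \<open>auto simp: frontier_def\<close>)
  then show ?thesis using Tm by (simp add: AE_restrict_space_iff)
qed

text \<open>Polynomial representatives turn the local energy into an integral of explicit gradients,
  and \<open>restr_eq\<close> carries the edge conditions over to them.\<close>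

lemma energy_orthogonal_on_triangle:
  assumes T: "2 simplex T"
    and p: "q\<^sub>p \<in> polynomials 1" "AE x in lebesgue_on T. p x = q\<^sub>p x"
    and v: "q\<^sub>v \<in> polynomials 1" "AE x in lebesgue_on T. v x = q\<^sub>v x"
    and w: "q\<^sub>w \<in> polynomials 2" "AE x in lebesgue_on T. w x = q\<^sub>w x"
    and edges: "\<And>a b. closed_segment a b edge_of T \<Longrightarrow>
      segment_integral a b (restr w T) = segment_integral a b (restr v T)"
  shows "(LINT x|lebesgue_on T. weak_gradient (interior T) p x \<bullet>
    weak_gradient (interior T) (\<lambda>x. v x - w x) x) = 0"
proof -
  obtain C where C: "\<not> affine_dependent C" "int (card C) = 2 + 1" "T = convex hull C"
    using T unfolding simplex_def by blast
  then obtain a b c where abc: "C = {a, b, c}" "a \<noteq> b" "a \<noteq> c" "b \<noteq> c"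
    by (auto simp: card_3_iff)
  have conv: "convex T" and comp: "compact T"
    using T convex_simplex compact_simplex by auto
  have Tm: "T \<in> sets lebesgue" using comp by (simp add: fmeasurableD lmeasurable_compact)
  have int: "interior T \<noteq> {}"
    using interior_convex_hull_eq_empty[of C] C by simp
  obtain kp gp where qp: "\<And>x. q\<^sub>p x = kp + gp \<bullet> x"
    using polynomials_1D[OF p(1)] by blast
  obtain kv gv where qv: "\<And>x. q\<^sub>v x = kv + gv \<bullet> x"
    using polynomials_1D[OF v(1)] by blast
  obtain kw gw A where A: "linear A" "\<And>x y. A x \<bullet> y = x \<bullet> A y"
    and qw: "\<And>x. q\<^sub>w x = kw + gw \<bullet> x + x \<bullet> A x"
    using polynomials_2D[OF w(1)] by blast
  \<comment> \<open>The quadratic part of \<open>v - w\<close> comes from \<open>w\<close> alone,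
    with a minus sign.\<close>
  define B where "B = (\<lambda>x. - A x)"
  have B: "linear B" "\<And>x y. B x \<bullet> y = x \<bullet> B y"
    unfolding B_def using A by (auto intro: linear_compose_neg)
  define r where "r = (\<lambda>x. (kv - kw) + (gv - gw) \<bullet> x + x \<bullet> B x)"
  have r: "r x = q\<^sub>v x - q\<^sub>w x" for x
    by (simp add: r_def B_def qv qw inner_diff_left)
  have Ac: "continuous_on S A" for S
    using linear_continuous_on[of A] A(1) by (simp add: linear_linear)
  have qvc: "continuous_on UNIV q\<^sub>v" and qwc: "continuous_on UNIV q\<^sub>w"
    unfolding qv[abs_def] qw[abs_def] by (intro continuous_intros Ac)+
  have edge: "integral {0..1} (\<lambda>t. r (linepath x y t)) = 0" if xy: "x \<in> C" "y \<in> C" "x \<noteq> y" for x y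
  proof -
    \<comment> \<open>Affine independence makes every pair of vertices span a face; being
      one-dimensional, it is an edge in the sense of \<open>edge_of\<close>.\<close>
    have "closed_segment x y face_of T"
      unfolding C(3) face_of_convex_hull_affine_independent[OF C(1)]
      using xy by (intro exI[of _ "{x, y}"]) (simp add: segment_convex_hull)
    moreover have "aff_dim (closed_segment x y) = 1"
      using xy by (simp add: segment_convex_hull aff_dim_convex_hull aff_dim_2)
    ultimately have "closed_segment x y edge_of T"
      by (simp add: edge_of_def)
    then have "segment_integral x y (restr w T) = segment_integral x y (restr v T)"
      by (rule edges)
    moreover have "linepath x y t \<in> T" if "t \<in> {0..1}" for t
      using \<open>closed_segment x y face_of T\<close> that linepath_in_path face_of_imp_subset by blast
    then have "integral {0..1} (\<lambda>t. restr w T (linepath x y t)) = integral {0..1} (\<lambda>t. q\<^sub>w (linepath x y t))"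
      "integral {0..1} (\<lambda>t. restr v T (linepath x y t)) = integral {0..1} (\<lambda>t. q\<^sub>v (linepath x y t))"
      using restr_eq[OF conv compact_imp_closed[OF comp] int] qvc qwc v(2) w(2)
      by (auto intro!: Henstock_Kurzweil_Integration.integral_cong)
    \<comment> \<open>The factor \<open>dist x y\<close> in \<open>segment_integral\<close> is
      nonzero for distinct end points, so it cancels.\<close>
    ultimately have "integral {0..1} (\<lambda>t. q\<^sub>w (linepath x y t)) = integral {0..1} (\<lambda>t. q\<^sub>v (linepath x y t))"
      using xy by (simp add: segment_integral_def)
    moreover have "(\<lambda>t. q (linepath x y t)) integrable_on {0..1}" if "continuous_on UNIV q" for q :: "real^2 \<Rightarrow> real"
      using that by (intro integrable_continuous_real continuous_on_compose2[OF that]) auto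
    ultimately show ?thesis
      unfolding r using qvc qwc by (simp add: Henstock_Kurzweil_Integration.integral_diff)
  qed
  have "AE x in lebesgue_on T. weak_gradient (interior T) p x = gp + 2 *\<^sub>R 0"
    by (rule weak_gradient_interior_AE[OF conv comp, where k=kp]) (use p qp in \<open>auto intro: linear_zero\<close>)
  moreover have "AE x in lebesgue_on T. v x - w x = (kv - kw) + (gv - gw) \<bullet> x + x \<bullet> B x"
    using v(2) w(2) by eventually_elim (simp add: r[unfolded r_def])
  then have "AE x in lebesgue_on T. weak_gradient (interior T) (\<lambda>x. v x - w x) x = (gv - gw) + 2 *\<^sub>R B x"
    by (rule weak_gradient_interior_AE[OF conv comp B])
  ultimately have ae: "AE x in lebesgue_on T. gp \<bullet> ((gv - gw) + 2 *\<^sub>R B x) =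
      weak_gradient (interior T) p x \<bullet> weak_gradient (interior T) (\<lambda>x. v x - w x) x"
    by eventually_elim simp
  have "continuous_on UNIV (\<lambda>x. gp \<bullet> ((gv - gw) + 2 *\<^sub>R B x))"
    unfolding B_def by (intro continuous_intros Ac)
  then have "(LINT x|lebesgue_on T. weak_gradient (interior T) p x \<bullet> weak_gradient (interior T) (\<lambda>x. v x - w x) x)
      = (LINT x|lebesgue_on T. gp \<bullet> ((gv - gw) + 2 *\<^sub>R B x))"
    by (intro integral_cong_AE_lebesgue_on[OF Tm _ ae] continuous_imp_borel_measurable_lebesgue_on[OF _ Tm])
  also have "\<dots> = 0"
    unfolding C(3) abc(1)
    by (rule triangle_gradient_orthogonal[OF C(1)[unfolded abc(1)] abc(2-4) B, of r "kv - kw"])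
       (use edge abc in \<open>auto simp: r_def\<close>)
  finally show ?thesis .
qed

theorem theorem3p4:
  fixes \<Omega> :: "(real^2) set" and \<T> :: "(real^2) set set" and \<sigma> :: real
    and I\<^sub>c :: "(real^2 \<Rightarrow> real) \<Rightarrow> (real^2 \<Rightarrow> real)"
    and p\<^sub>h :: "real^2 \<Rightarrow> real"
  assumes "convex_polygonal_domain \<Omega>"
    and "conforming_mesh \<Omega> \<T>"
    and "shape_regular \<sigma> \<T>"
    and "enriching_map \<Omega> \<T> I\<^sub>c"
    and "square_integrable \<Omega> p\<^sub>h"
    and "piecewise_polynomial 1 \<T> p\<^sub>h"
  shows "\<forall>v\<^sub>h\<in>CR0 \<Omega> \<T>. a_pw \<T> p\<^sub>h (\<lambda>x. v\<^sub>h x - I\<^sub>c v\<^sub>h x) = 0"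
proof
  fix v\<^sub>h assume v: "v\<^sub>h \<in> CR0 \<Omega> \<T>"
  have w: "is_enrichment \<Omega> \<T> v\<^sub>h (I\<^sub>c v\<^sub>h)"
    using assms(4) v by (simp add: enriching_map_def)
  show "a_pw \<T> p\<^sub>h (\<lambda>x. v\<^sub>h x - I\<^sub>c v\<^sub>h x) = 0"
    unfolding a_pw_def
  \<comment> \<open>Each summand vanishes by itself, without cancellation across edges;
    \<open>is_enrichment\<close> supplies the edge integrals on every triangle.\<close>
  proof (rule sum.neutral, rule ballI)
    fix T assume T: "T \<in> \<T>"
    obtain q\<^sub>p where "q\<^sub>p \<in> polynomials 1" "AE x in lebesgue_on T. p\<^sub>h x = q\<^sub>p x"
      using assms(6) T unfolding piecewise_polynomial_def by blast
    moreover obtain q\<^sub>v where "q\<^sub>v \<in> polynomials 1" "AE x in lebesgue_on T. v\<^sub>h x = q\<^sub>v x"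
      using v T unfolding CR0_def CR_def piecewise_polynomial_def by blast
    moreover obtain q\<^sub>w where "q\<^sub>w \<in> polynomials 2" "AE x in lebesgue_on T. I\<^sub>c v\<^sub>h x = q\<^sub>w x"
      using w T unfolding is_enrichment_def Vc_def piecewise_polynomial_def by blast
    moreover have "2 simplex T"
      using assms(2) T by (simp add: conforming_mesh_def)
    ultimately show "(LINT x|lebesgue_on T. weak_gradient (interior T) p\<^sub>h x \<bullet>
        weak_gradient (interior T) (\<lambda>x. v\<^sub>h x - I\<^sub>c v\<^sub>h x) x) = 0"
      using w T by (intro energy_orthogonal_on_triangle) (auto simp: is_enrichment_def)
  qed
qed

end
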